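(* \[ {\bf B}_a^k = \sum_{b=a}^n p^{ka-b}S_{a,a}(k,b){\mathbf B}_b, \] where the generalized Stirling numbers are $S_{r, s}(n, k):=\frac {(-1)^k}{k!}\sum_{p=s}^k(-1)^p{ k \choose p }\prod_{j=1}^p\Bigl(p + (j-1)(r-s)\Bigr)^{ \underline{s} }$ with $m^{\underline{s}}:=m (m-1) \cdots (m-s+1)$ (here $p$ is a summation index); equivalently $S_{a,a}(k,b)=\frac{(-1)^b}{b!}\sum_{i=a}^b(-1)^i\binom{b}{i}\bigl(a!\binom{i}{a}\bigr)^k$.
   Context: $G_{n,p}=C_p\wr\mathfrak S_n$ is the colored permutation group (pairs $(s,\sigma)$, $s\in C_p^n$, $\sigma\in\mathfrak S_n$, product $(t,\tau)(s,\sigma)=(\sigma t+s,\tau\sigma)$, $\sigma t=(t_{\sigma(1)},\ldots,t_{\sigma(n)})$), whose elements are regarded as words $(s_1,\sigma(1))\cdots(s_n,\sigma(n))$ over $C_p\times[n]$. For words $u,v$, $u\sqcup\!\sqcup v$ is the shuffle product (formal sum of all interleavings). Let $W_{k,n}=(0,k+1)(0,k+2)\cdots(0,n)$ and define in ${\mathbb Q}G_{n,p}$: ${\mathbf B}_0=id$, ${\mathbf B}_k=\sum_{\alpha\in G_{k,p}}\alpha\sqcup\!\sqcup W_{k,n}$ for $1\le k\le n-1$, ${\mathbf B}_n=\sum_{\alpha\in G_{n,p}}\alpha$.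
   Formalization: The product in S_{r,s}(n,k) is taken up to j=n instead of the misprinted summation index p, in agreement with the "equivalently" formula, and the power k is assumed to be at least 1, since the identity fails for k=0 (e.g. n=2, a=1, p=1). *)

theory Defs
  imports "HOL-Algebra.Algebra" "HOL-Combinatorics.Permutations" "HOL-Library.Multiset"
begin

type_synonym colored_perm = "(nat \<Rightarrow> int) \<times> (nat \<Rightarrow> nat)"

(* The cyclic group C_p is written additively on paper; the operation of integer_mod_group p
   is addition modulo p. The i-th entry of \<sigma>t + s is t (\<sigma> i) + s i. *)
definition colored_perm_group :: "nat \<Rightarrow> nat \<Rightarrow> colored_perm monoid" where
  "colored_perm_group n p =
    \<lparr>carrier = ({1..n} \<rightarrow>\<^sub>E carrier (integer_mod_group p)) \<times> {\<sigma>. \<sigma> permutes {1..n}},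
     monoid.mult = (\<lambda>(t, \<tau>) (s, \<sigma>).
       ((\<lambda>i\<in>{1..n}. t (\<sigma> i) \<otimes>\<^bsub>integer_mod_group p\<^esub> s i), \<tau> \<circ> \<sigma>)),
     one = ((\<lambda>i\<in>{1..n}. \<one>\<^bsub>integer_mod_group p\<^esub>), id)\<rparr>"

(* The group algebra of G over the rationals, for finite G: an element is its coefficient
   function, which vanishes off the carrier of G. *)
definition rat_group_algebra :: "('a, 'b) monoid_scheme \<Rightarrow> ('a \<Rightarrow> rat) ring" where
  "rat_group_algebra G =
    \<lparr>carrier = {f. \<forall>x. x \<notin> carrier G \<longrightarrow> f x = 0},
     monoid.mult = (\<lambda>f g x.
       \<Sum>(y, z)\<in>{(y, z). y \<in> carrier G \<and> z \<in> carrier G \<and> y \<otimes>\<^bsub>G\<^esub> z = x}. f y * g z),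
     one = (\<lambda>x. if x = \<one>\<^bsub>G\<^esub> then 1 else 0),
     ring.zero = (\<lambda>x. 0),
     add = (\<lambda>f g x. f x + g x)\<rparr>"

definition word_of :: "nat \<Rightarrow> colored_perm \<Rightarrow> (int \<times> nat) list" where
  "word_of n g = map (\<lambda>i. (fst g i, snd g i)) [1..<Suc n]"

(* The shuffle product of two words, a formal sum encoded as a multiset: an interleaving
   occurs as often as it arises, whereas the library function shuffles is only the support. *)
fun shuffle_product :: "'a list \<Rightarrow> 'a list \<Rightarrow> 'a list multiset" where
  "shuffle_product [] v = {#v#}"
| "shuffle_product u [] = {#u#}"
| "shuffle_product (x # u) (y # v) =
     image_mset (Cons x) (shuffle_product u (y # v)) + image_mset (Cons y) (shuffle_product (x # u) v)"

lemma set_mset_shuffle_product: "set_mset (shuffle_product u v) = shuffles u v"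
  by (induction u v rule: shuffle_product.induct) auto

definition W :: "nat \<Rightarrow> nat \<Rightarrow> (int \<times> nat) list" where
  "W k n = map (\<lambda>i. (0, i)) [Suc k..<Suc n]"

(* The element B_k of the group algebra of colored_perm_group n p, for k \<le> n. *)
definition B :: "nat \<Rightarrow> nat \<Rightarrow> nat \<Rightarrow> colored_perm \<Rightarrow> rat" where
  "B n p k g =
    (if g \<notin> carrier (colored_perm_group n p) then 0
     else if k = 0 then (if g = \<one>\<^bsub>colored_perm_group n p\<^esub> then 1 else 0)
     else if k < n then
       (\<Sum>\<alpha>\<in>carrier (colored_perm_group k p).
          of_nat (count (shuffle_product (word_of k \<alpha>) (W k n)) (word_of n g)))
     else 1)"

definition falling_factorial :: "int \<Rightarrow> nat \<Rightarrow> int" where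
  "falling_factorial m s = (\<Prod>j<s. m - int j)"

(* S_{r,s}(n,k). The product runs over j = 1, ..., n, so that for r = s = a it is
   (a! * (i choose a)) ^ n. *)
definition gen_stirling :: "nat \<Rightarrow> nat \<Rightarrow> nat \<Rightarrow> nat \<Rightarrow> rat" where
  "gen_stirling r s n k =
    (- 1) ^ k / fact k *
    (\<Sum>i = s..k. (- 1) ^ i * of_nat (k choose i) *
       (\<Prod>j = 1..n. of_int (falling_factorial (int i + (int j - 1) * (int r - int s)) s)))"

lemma gen_stirling_diag:
  "gen_stirling a a k b =
    (- 1) ^ b / fact b *
    (\<Sum>i = a..b. (- 1) ^ i * of_nat (b choose i) * (fact a * of_nat (i choose a)) ^ k)"
proof -
  have "of_int (falling_factorial (int i) a) = (fact a * of_nat (i choose a) :: rat)" for i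
  proof -
    have "(of_nat (i choose a) :: rat) = of_nat i gchoose a"
      by (simp add: binomial_gbinomial)
    also have "\<dots> = (\<Prod>j<a. of_nat i - of_nat j) / fact a"
      by (simp add: gbinomial_prod_rev lessThan_atLeast0)
    finally show ?thesis
      by (simp add: falling_factorial_def)
  qed
  then show ?thesis
    by (simp add: gen_stirling_def)
qed

lemma group_colored_perm_group: "group (colored_perm_group n p)"
proof -
  define C where "C = integer_mod_group p"
  define I where "I = {1..n}"
  define G where "G = colored_perm_group n p"
  interpret C: group C by (simp add: C_def)
  have app: "\<sigma> i \<in> I" if "\<sigma> permutes I" "i \<in> I" for \<sigma> i
    using permutes_in_image[OF that(1)] that(2) by blast
  have mem: "f i \<in> carrier C" if "f \<in> I \<rightarrow>\<^sub>E carrier C" "i \<in> I" for f i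
    using that by (rule PiE_mem)
  note G = colored_perm_group_def[of n p, folded C_def I_def G_def]
  have "group G"
  proof (rule groupI)
    fix x y assume "x \<in> carrier G" "y \<in> carrier G"
    then show "x \<otimes>\<^bsub>G\<^esub> y \<in> carrier G"
      by (auto simp: G app permutes_compose mem)
  next
    show "\<one>\<^bsub>G\<^esub> \<in> carrier G"
      by (auto simp: G permutes_id)
  next
    fix x y z assume "x \<in> carrier G" "y \<in> carrier G" "z \<in> carrier G"
    then obtain r \<rho> s \<sigma> t \<tau> where "x = (r, \<rho>)" "y = (s, \<sigma>)" "z = (t, \<tau>)"
      and "r \<in> I \<rightarrow>\<^sub>E carrier C" "s \<in> I \<rightarrow>\<^sub>E carrier C" "t \<in> I \<rightarrow>\<^sub>E carrier C"
      and "\<rho> permutes I" "\<sigma> permutes I" "\<tau> permutes I"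
      by (auto simp: G)
    then show "x \<otimes>\<^bsub>G\<^esub> y \<otimes>\<^bsub>G\<^esub> z = x \<otimes>\<^bsub>G\<^esub> (y \<otimes>\<^bsub>G\<^esub> z)"
      by (auto simp: G fun_eq_iff app C.m_assoc mem)
  next
    fix x assume "x \<in> carrier G"
    then obtain s \<sigma> where x: "x = (s, \<sigma>)" and s: "s \<in> I \<rightarrow>\<^sub>E carrier C" and \<sigma>: "\<sigma> permutes I"
      by (auto simp: G)
    have "(\<lambda>i\<in>I. \<one>\<^bsub>C\<^esub> \<otimes>\<^bsub>C\<^esub> s i) = (\<lambda>i\<in>I. s i)"
      by (rule restrict_ext) (simp add: mem[OF s])
    also have "\<dots> = s"
      using s by (simp add: PiE_def extensional_restrict)
    finally have eq: "(\<lambda>i\<in>I. \<one>\<^bsub>C\<^esub> \<otimes>\<^bsub>C\<^esub> s i) = s" .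
    have "\<one>\<^bsub>G\<^esub> \<otimes>\<^bsub>G\<^esub> x = ((\<lambda>i\<in>I. \<one>\<^bsub>C\<^esub> \<otimes>\<^bsub>C\<^esub> s i), \<sigma>)"
      using app[OF \<sigma>] by (auto simp: G x intro!: restrict_ext)
    then show "\<one>\<^bsub>G\<^esub> \<otimes>\<^bsub>G\<^esub> x = x"
      by (simp only: eq x)
    define \<rho> where "\<rho> = Hilbert_Choice.inv \<sigma>"
    have \<rho>: "\<rho> permutes I" "\<And>i. \<rho> (\<sigma> i) = i"
      using permutes_inv[OF \<sigma>] permutes_inverses[OF \<sigma>] by (simp_all add: \<rho>_def)
    let ?y = "((\<lambda>i\<in>I. inv\<^bsub>C\<^esub> s (\<rho> i)), \<rho>)"
    have "?y \<in> carrier G"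
      using s \<rho>(1) by (auto simp: G app mem)
    moreover have "?y \<otimes>\<^bsub>G\<^esub> x = \<one>\<^bsub>G\<^esub>"
      using s \<sigma> \<rho> by (auto simp: G x fun_eq_iff app mem)
    ultimately show "\<exists>y\<in>carrier G. y \<otimes>\<^bsub>G\<^esub> x = \<one>\<^bsub>G\<^esub>"
      by blast
  qed
  then show ?thesis
    by (simp add: G_def)
qed

end

(* Let S_b be the set of colored permutations in whose word the letters with value above b have
   color 0 and appear in increasing order; then B_b is the indicator function of S_b. The inverses
   of the elements of S_1 move the letter 1 to a value m and add a color c to it, so counting the
   pairs (c, m) that bring a given g into S_b yields B_1 B_b = p b B_b + B_(b+1), where B_(n+1) = 0.
   Consequently the elements
     E_i = sum over b of (-1)^(b+i) (b choose i) / (b! p^b) B_b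
   satisfy B_1 E_i = p i E_i, and by induction on b also B_b E_i = p^b b! (i choose b) E_i. They sum
   to 1, so B_a^k is the sum over i of (p^a a! (i choose a))^k E_i, which is the claim. *)
theory Submission
  imports Defs
begin

section \<open>The product of the rational group algebra\<close>

lemma rat_group_algebra_mult_notin:
  assumes "group G" "x \<notin> carrier G"
  shows "(f \<otimes>\<^bsub>rat_group_algebra G\<^esub> g) x = 0"
proof -
  interpret group G by fact
  have "{(y, z). y \<in> carrier G \<and> z \<in> carrier G \<and> y \<otimes>\<^bsub>G\<^esub> z = x} = {}"
    using assms(2) by auto
  then show ?thesis
    by (simp only: rat_group_algebra_def monoid.simps sum.empty)
qed

text \<open>A factorization of \<open>x\<close> is determined by its left factor \<open>y\<close>,
  so the convolution becomes a sum over one variable.\<close>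

lemma rat_group_algebra_mult:
  assumes "group G" "x \<in> carrier G"
  shows "(f \<otimes>\<^bsub>rat_group_algebra G\<^esub> g) x = (\<Sum>y\<in>carrier G. f y * g (inv\<^bsub>G\<^esub> y \<otimes>\<^bsub>G\<^esub> x))"
proof -
  interpret group G by fact
  have "(\<Sum>(y, z)\<in>{(y, z). y \<in> carrier G \<and> z \<in> carrier G \<and> y \<otimes>\<^bsub>G\<^esub> z = x}. f y * g z) =
      (\<Sum>y\<in>carrier G. f y * g (inv\<^bsub>G\<^esub> y \<otimes>\<^bsub>G\<^esub> x))"
    using assms(2)
    by (intro sum.reindex_bij_witness[of _ "\<lambda>y. (y, inv\<^bsub>G\<^esub> y \<otimes>\<^bsub>G\<^esub> x)" fst])
       (auto simp: m_assoc[symmetric])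
  then show ?thesis
    by (simp add: rat_group_algebra_def)
qed

lemma rat_group_algebra_mult_sum_right:
  "f \<otimes>\<^bsub>rat_group_algebra G\<^esub> (\<lambda>x. \<Sum>i\<in>I. c i * h i x) =
    (\<lambda>x. \<Sum>i\<in>I. c i * (f \<otimes>\<^bsub>rat_group_algebra G\<^esub> h i) x)"
proof
  fix x
  let ?P = "{(y, z). y \<in> carrier G \<and> z \<in> carrier G \<and> y \<otimes>\<^bsub>G\<^esub> z = x}"
  have "(\<Sum>q\<in>?P. f (fst q) * (\<Sum>i\<in>I. c i * h i (snd q))) =
      (\<Sum>i\<in>I. c i * (\<Sum>q\<in>?P. f (fst q) * h i (snd q)))"
    by (simp add: sum_distrib_left sum.swap[of _ I] mult.left_commute)
  then show "(f \<otimes>\<^bsub>rat_group_algebra G\<^esub> (\<lambda>x. \<Sum>i\<in>I. c i * h i x)) x =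
      (\<Sum>i\<in>I. c i * (f \<otimes>\<^bsub>rat_group_algebra G\<^esub> h i) x)"
    by (simp add: rat_group_algebra_def case_prod_beta)
qed

lemma rat_group_algebra_mult_scale_right:
  "f \<otimes>\<^bsub>rat_group_algebra G\<^esub> (\<lambda>x. c * h x) = (\<lambda>x. c * (f \<otimes>\<^bsub>rat_group_algebra G\<^esub> h) x)"
  \<comment> \<open>A single scalar multiple is a linear combination over the one-point index set
    \<open>{()}\<close>.\<close>
  using rat_group_algebra_mult_sum_right[where c = "\<lambda>_. c" and h = "\<lambda>_. h" and I = "{()}"] by simp

lemma rat_group_algebra_mult_lincomb_left:
  "(\<lambda>x. c * f x + d * h x) \<otimes>\<^bsub>rat_group_algebra G\<^esub> g =
    (\<lambda>x. c * (f \<otimes>\<^bsub>rat_group_algebra G\<^esub> g) x + d * (h \<otimes>\<^bsub>rat_group_algebra G\<^esub> g) x)"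
  by (simp add: rat_group_algebra_def fun_eq_iff case_prod_beta sum_distrib_left
      sum.distrib[symmetric] algebra_simps)

text \<open>The powers \<open>[^]\<close>, the associativity used in the eigenvalue recursion and
  the final insertion of \<open>\<one>\<close> rest on this; linearity is supplied by the lemmas
  above.\<close>

lemma monoid_rat_group_algebra:
  assumes "group G" "finite (carrier G)"
  shows "monoid (rat_group_algebra G)"
proof -
  interpret group G by fact
  let ?A = "rat_group_algebra G"
  note mult = rat_group_algebra_mult[OF assms(1)]
  have carrier: "f \<in> carrier ?A \<longleftrightarrow> (\<forall>x. x \<notin> carrier G \<longrightarrow> f x = 0)" for f
    by (simp add: rat_group_algebra_def)
  have one: "\<one>\<^bsub>?A\<^esub> = (\<lambda>x. if x = \<one>\<^bsub>G\<^esub> then 1 else 0)"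
    by (simp add: rat_group_algebra_def)
  have eqI: "f = g" if "f \<in> carrier ?A" "g \<in> carrier ?A" "\<And>x. x \<in> carrier G \<Longrightarrow> f x = g x" for f g
  proof
    fix x
    show "f x = g x"
      using that by (cases "x \<in> carrier G") (auto simp: carrier)
  qed
  have closed: "f \<otimes>\<^bsub>?A\<^esub> g \<in> carrier ?A" for f g
    by (simp add: carrier rat_group_algebra_mult_notin[OF assms(1)])
  have one_closed: "\<one>\<^bsub>?A\<^esub> \<in> carrier ?A"
    by (auto simp: carrier one)
  show ?thesis
  proof (rule monoidI)
    fix f g h
    show "f \<otimes>\<^bsub>?A\<^esub> g \<otimes>\<^bsub>?A\<^esub> h = f \<otimes>\<^bsub>?A\<^esub> (g \<otimes>\<^bsub>?A\<^esub> h)"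
    proof (rule eqI[OF closed closed])
      fix x assume x: "x \<in> carrier G"
      have "(f \<otimes>\<^bsub>?A\<^esub> g \<otimes>\<^bsub>?A\<^esub> h) x =
          (\<Sum>z\<in>carrier G. f z * (\<Sum>y\<in>carrier G. g (inv\<^bsub>G\<^esub> z \<otimes>\<^bsub>G\<^esub> y) * h (inv\<^bsub>G\<^esub> y \<otimes>\<^bsub>G\<^esub> x)))"
        using x by (simp add: mult sum_distrib_left sum_distrib_right mult.assoc) (rule sum.swap)
      \<comment> \<open>For fixed \<open>z\<close> the inner sums agree under the substitution
        \<open>y = z \<otimes> w\<close>.\<close>
      also have "\<dots> = (\<Sum>z\<in>carrier G. f z *
          (\<Sum>w\<in>carrier G. g w * h (inv\<^bsub>G\<^esub> w \<otimes>\<^bsub>G\<^esub> (inv\<^bsub>G\<^esub> z \<otimes>\<^bsub>G\<^esub> x))))"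
      proof (rule sum.cong[OF refl], rule arg_cong[where f = "(*) (f _)"])
        fix z assume z: "z \<in> carrier G"
        have cancel: "z \<otimes>\<^bsub>G\<^esub> (inv\<^bsub>G\<^esub> z \<otimes>\<^bsub>G\<^esub> y) = y" "inv\<^bsub>G\<^esub> z \<otimes>\<^bsub>G\<^esub> (z \<otimes>\<^bsub>G\<^esub> y) = y"
          if "y \<in> carrier G" for y
          using z that by (simp_all flip: m_assoc)
        have cancel': "inv\<^bsub>G\<^esub> (inv\<^bsub>G\<^esub> z \<otimes>\<^bsub>G\<^esub> y) \<otimes>\<^bsub>G\<^esub> (inv\<^bsub>G\<^esub> z \<otimes>\<^bsub>G\<^esub> x) = inv\<^bsub>G\<^esub> y \<otimes>\<^bsub>G\<^esub> x"
          if "y \<in> carrier G" for y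
          using x z that by (simp add: inv_mult_group m_assoc cancel)
        show "(\<Sum>y\<in>carrier G. g (inv\<^bsub>G\<^esub> z \<otimes>\<^bsub>G\<^esub> y) * h (inv\<^bsub>G\<^esub> y \<otimes>\<^bsub>G\<^esub> x)) =
            (\<Sum>w\<in>carrier G. g w * h (inv\<^bsub>G\<^esub> w \<otimes>\<^bsub>G\<^esub> (inv\<^bsub>G\<^esub> z \<otimes>\<^bsub>G\<^esub> x)))"
          using x z
          by (intro sum.reindex_bij_witness[of _ "\<lambda>w. z \<otimes>\<^bsub>G\<^esub> w" "\<lambda>y. inv\<^bsub>G\<^esub> z \<otimes>\<^bsub>G\<^esub> y"])
             (simp_all add: cancel cancel')
      qed
      also have "\<dots> = (f \<otimes>\<^bsub>?A\<^esub> (g \<otimes>\<^bsub>?A\<^esub> h)) x"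
        using x by (simp add: mult)
      finally show "(f \<otimes>\<^bsub>?A\<^esub> g \<otimes>\<^bsub>?A\<^esub> h) x = (f \<otimes>\<^bsub>?A\<^esub> (g \<otimes>\<^bsub>?A\<^esub> h)) x" .
    qed
  next
    fix f assume f: "f \<in> carrier ?A"
    show "\<one>\<^bsub>?A\<^esub> \<otimes>\<^bsub>?A\<^esub> f = f"
    proof (rule eqI[OF closed f])
      fix x assume x: "x \<in> carrier G"
      have "(\<one>\<^bsub>?A\<^esub> \<otimes>\<^bsub>?A\<^esub> f) x = (\<Sum>y\<in>carrier G. if y = \<one>\<^bsub>G\<^esub> then f x else 0)"
        unfolding mult[OF x] one using x by (intro sum.cong) auto
      then show "(\<one>\<^bsub>?A\<^esub> \<otimes>\<^bsub>?A\<^esub> f) x = f x"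
        using assms(2) by simp
    qed
    show "f \<otimes>\<^bsub>?A\<^esub> \<one>\<^bsub>?A\<^esub> = f"
    proof (rule eqI[OF closed f])
      fix x assume x: "x \<in> carrier G"
      have "inv\<^bsub>G\<^esub> y \<otimes>\<^bsub>G\<^esub> x = \<one>\<^bsub>G\<^esub> \<longleftrightarrow> y = x" if "y \<in> carrier G" for y
        using that x by (metis inv_closed inv_equality inv_inv l_inv)
      then have "(f \<otimes>\<^bsub>?A\<^esub> \<one>\<^bsub>?A\<^esub>) x = (\<Sum>y\<in>carrier G. if y = x then f y else 0)"
        unfolding mult[OF x] one by (intro sum.cong) auto
      then show "(f \<otimes>\<^bsub>?A\<^esub> \<one>\<^bsub>?A\<^esub>) x = f x"
        using x assms(2) by simp
    qed
  qed (use closed one_closed in auto)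
qed

section \<open>Multiplicities in shuffle products\<close>

text \<open>When \<open>P\<close> separates the letters of the two words, an interleaving can be
  undone by filtering, so no word arises twice. In the induction, \<open>P\<close> on the first
  letter of \<open>w\<close> decides which of the two summands can produce \<open>w\<close>.\<close>

lemma count_shuffle_product:
  assumes "\<forall>x\<in>set u. P x" "\<forall>y\<in>set v. \<not> P y"
  shows "count (shuffle_product u v) w = of_bool (filter P w = u \<and> filter (\<lambda>x. \<not> P x) w = v)"
  using assms
proof (induction u v arbitrary: w rule: shuffle_product.induct)
  case (1 v)
  have "filter P w = [] \<and> filter (\<lambda>x. \<not> P x) w = v \<longleftrightarrow> w = v"
    using 1 by (auto simp: filter_empty_conv intro: filter_True)
  then show ?case by auto
next
  case (2 x u)
  have "filter P w = x # u \<and> filter (\<lambda>x. \<not> P x) w = [] \<longleftrightarrow> w = x # u"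
    using 2 by (auto simp: filter_empty_conv intro: filter_True)
  then show ?case by auto
next
  case (3 x u y v)
  have count_Cons: "count (image_mset (Cons a) M) w =
      (case w of [] \<Rightarrow> 0 | b # w' \<Rightarrow> if a = b then count M w' else 0)" for a :: 'a and M and w
    by (induction M) (auto split: list.splits)
  have xy: "P x" "\<not> P y"
    using "3.prems" by auto
  have IH: "count (shuffle_product u (y # v)) w' = of_bool (filter P w' = u \<and> filter (\<lambda>x. \<not> P x) w' = y # v)"
    "count (shuffle_product (x # u) v) w' = of_bool (filter P w' = x # u \<and> filter (\<lambda>x. \<not> P x) w' = v)" for w'
    using 3 by simp_all
  show ?case
  proof (cases w)
    case (Cons z w')
    then show ?thesis
      using xy by (cases "P z") (auto simp: count_Cons IH)
  qed (simp add: count_Cons)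
qed

section \<open>Basic facts on the colored permutation group\<close>

lemma carrier_colored_perm_group:
  "carrier (colored_perm_group n p) =
    ({1..n} \<rightarrow>\<^sub>E carrier (integer_mod_group p)) \<times> {\<sigma>. \<sigma> permutes {1..n}}"
  by (simp add: colored_perm_group_def)

lemma finite_colored_perm_group:
  "p \<ge> 1 \<Longrightarrow> finite (carrier (colored_perm_group n p))"
  by (auto simp: carrier_colored_perm_group carrier_integer_mod_group
      intro!: finite_PiE finite_permutations)

lemma ex_snd_eq:
  assumes "g \<in> carrier (colored_perm_group n p)" "j \<in> {1..n}"
  shows "\<exists>i\<in>{1..n}. snd g i = j"
proof -
  have "snd g permutes {1..n}"
    using assms(1) by (auto simp: carrier_colored_perm_group)
  then have "j \<in> snd g ` {1..n}"
    using assms(2) by (simp only: permutes_image)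
  then show ?thesis
    by blast
qed

section \<open>Renaming values by left multiplication\<close>

text \<open>Membership in the set S_b of the overview. It is phrased by positions in the word, which
  left multiplication keeps in place while it renames values and adds colors.\<close>

definition tail_in_order :: "nat \<Rightarrow> nat \<Rightarrow> colored_perm \<Rightarrow> bool" where
  "tail_in_order n b g \<longleftrightarrow>
    (\<forall>i\<in>{1..n}. b < snd g i \<longrightarrow> fst g i = 0) \<and>
    (\<forall>i\<in>{1..n}. \<forall>j\<in>{1..n}. i < j \<and> b < snd g i \<and> b < snd g j \<longrightarrow> snd g i < snd g j)"

(* Left multiplication by this element renames the values of a word: 1 becomes m, with c added
   to its color, and 2, ..., m move down by one. *)
definition move_first :: "nat \<Rightarrow> int \<Rightarrow> nat \<Rightarrow> colored_perm" where
  "move_first n c m =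
    (\<lambda>i\<in>{1..n}. if i = 1 then c else 0, \<lambda>j. if j = 1 then m else if 1 < j \<and> j \<le> m then j - 1 else j)"

lemma move_first_carrier:
  assumes "c \<in> carrier (integer_mod_group p)" "m \<in> {1..n}"
  shows "move_first n c m \<in> carrier (colored_perm_group n p)"
proof -
  have "snd (move_first n c m) permutes {1..n}"
  proof (rule bij_imp_permutes)
    \<comment> \<open>The witness undoes the renaming: \<open>m\<close> returns to 1 and the values
      below \<open>m\<close> move up by one.\<close>
    show "bij_betw (snd (move_first n c m)) {1..n} {1..n}"
      using assms(2)
      by (intro bij_betw_byWitness[where f' = "\<lambda>j. if j = m then 1 else if j < m then j + 1 else j"])
         (auto simp: move_first_def)
  qed (use assms(2) in \<open>auto simp: move_first_def\<close>)
  then show ?thesis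
    using assms(1) by (auto simp: move_first_def carrier_colored_perm_group)
qed

lemma move_first_mult:
  assumes "g \<in> carrier (colored_perm_group n p)" "i \<in> {1..n}" "p \<ge> 1"
  shows "fst (move_first n c m \<otimes>\<^bsub>colored_perm_group n p\<^esub> g) i =
      (if snd g i = 1 then (c + fst g i) mod int p else fst g i)"
    and "snd (move_first n c m \<otimes>\<^bsub>colored_perm_group n p\<^esub> g) i =
      (if snd g i = 1 then m else if snd g i \<le> m then snd g i - 1 else snd g i)"
    and "snd g i \<in> {1..n}"
proof -
  obtain s \<sigma> where g: "g = (s, \<sigma>)" by force
  \<comment> \<open>\<open>s i\<close> is already reduced modulo \<open>p\<close>, so adding color 0
    away from the value 1 leaves it unchanged.\<close>
  have s: "s i \<in> {0..<int p}" and \<sigma>: "\<sigma> i \<in> {1..n}"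
    using assms permutes_in_image[of \<sigma> "{1..n}" i]
    by (auto simp: g carrier_colored_perm_group carrier_integer_mod_group)
  then show "fst (move_first n c m \<otimes>\<^bsub>colored_perm_group n p\<^esub> g) i =
      (if snd g i = 1 then (c + fst g i) mod int p else fst g i)"
    "snd (move_first n c m \<otimes>\<^bsub>colored_perm_group n p\<^esub> g) i =
      (if snd g i = 1 then m else if snd g i \<le> m then snd g i - 1 else snd g i)"
    "snd g i \<in> {1..n}"
    using assms(2) by (auto simp: g move_first_def colored_perm_group_def)
qed

text \<open>For \<open>m \<le> b\<close> the renaming permutes the values up to \<open>m\<close>
  among themselves and recolors only the value 1, so the letters above \<open>b\<close> are
  untouched.\<close>

lemma tail_in_order_move_first_le:
  assumes "g \<in> carrier (colored_perm_group n p)" "p \<ge> 1" "m \<in> {1..b}"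
  shows "tail_in_order n b (move_first n c m \<otimes>\<^bsub>colored_perm_group n p\<^esub> g) \<longleftrightarrow> tail_in_order n b g"
proof -
  let ?h = "move_first n c m \<otimes>\<^bsub>colored_perm_group n p\<^esub> g"
  have "b < snd ?h i \<longleftrightarrow> b < snd g i" "b < snd g i \<Longrightarrow> fst ?h i = fst g i \<and> snd ?h i = snd g i"
    if "i \<in> {1..n}" for i
    using move_first_mult(1,2)[OF assms(1) that assms(2), of c m] move_first_mult(3)[OF assms(1) that assms(2)] assms(3) by auto
  then show ?thesis
    unfolding tail_in_order_def by (intro conj_cong ball_cong refl) auto
qed

text \<open>After the renaming, the letters above \<open>b\<close> are those of \<open>g\<close>
  above \<open>Suc b\<close>, in unchanged relative order, together with the former letter 1, which
  keeps its position \<open>q\<close> and now has value \<open>m\<close>. Its color must vanish, and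
  \<open>q\<close> must separate the values up to \<open>m\<close> from the larger ones.\<close>

lemma tail_in_order_move_first_gt:
  assumes g: "g \<in> carrier (colored_perm_group n p)" "p \<ge> 1" and m: "b < m"
    and q: "q \<in> {1..n}" "snd g q = 1"
  shows "tail_in_order n b (move_first n c m \<otimes>\<^bsub>colored_perm_group n p\<^esub> g) \<longleftrightarrow>
    tail_in_order n (Suc b) g \<and> (c + fst g q) mod int p = 0 \<and>
    (\<forall>i\<in>{1..n}. Suc b < snd g i \<longrightarrow> (i < q \<longleftrightarrow> snd g i \<le> m))"
proof -
  let ?h = "move_first n c m \<otimes>\<^bsub>colored_perm_group n p\<^esub> g"
  have "inj (snd g)"
    using g permutes_inj by (auto simp: carrier_colored_perm_group)
  then have one: "snd g i = 1 \<longleftrightarrow> i = q" for i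
    using q by (metis injD)
  have h: "fst ?h i = (if i = q then (c + fst g i) mod int p else fst g i)"
    "snd ?h i = (if i = q then m else if snd g i \<le> m then snd g i - 1 else snd g i)"
    "snd g i \<in> {1..n}" if "i \<in> {1..n}" for i
    using move_first_mult[OF g(1) that g(2)] unfolding one by blast+
  have h_q: "fst ?h q = (c + fst g q) mod int p" "snd ?h q = m"
    using h(1,2)[OF q(1)] by auto
  \<comment> \<open>For \<open>b > 0\<close> the value \<open>Suc b\<close> drops to
    \<open>b\<close>, because \<open>Suc b \<le> m\<close>; for \<open>b = 0\<close> it is the
    letter at \<open>q\<close> itself. Either way the threshold for the other letters becomes
    \<open>Suc b\<close>.\<close>
  have above: "b < snd ?h i \<longleftrightarrow> i = q \<or> Suc b < snd g i" if "i \<in> {1..n}" for i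
    using h[OF that] m one[of i] by auto
  have above': "i \<noteq> q" "fst ?h i = fst g i" "snd ?h i = (if snd g i \<le> m then snd g i - 1 else snd g i)"
    if "i \<in> {1..n}" "Suc b < snd g i" for i
    using h[OF that(1)] that(2) q by auto
  have "(\<forall>i\<in>{1..n}. b < snd ?h i \<longrightarrow> fst ?h i = 0) \<longleftrightarrow>
      (\<forall>i\<in>{1..n}. i = q \<or> Suc b < snd g i \<longrightarrow> fst ?h i = 0)"
    using above by simp
  also have "\<dots> \<longleftrightarrow> fst ?h q = 0 \<and> (\<forall>i\<in>{1..n}. Suc b < snd g i \<longrightarrow> fst ?h i = 0)"
    using q(1) by blast
  also have "\<dots> \<longleftrightarrow> (c + fst g q) mod int p = 0 \<and> (\<forall>i\<in>{1..n}. Suc b < snd g i \<longrightarrow> fst g i = 0)"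
    using above'(2) h_q(1) by simp
  finally have color: "(\<forall>i\<in>{1..n}. b < snd ?h i \<longrightarrow> fst ?h i = 0) \<longleftrightarrow>
      (c + fst g q) mod int p = 0 \<and> (\<forall>i\<in>{1..n}. Suc b < snd g i \<longrightarrow> fst g i = 0)" .
  \<comment> \<open>Values of \<open>g\<close> up to \<open>m\<close> drop by one and larger ones
    stay. So the order of the letters other than 1 is kept, and a gap opens at \<open>m\<close>,
    which the letter at \<open>q\<close> fills.\<close>
  have mono: "snd ?h i < snd ?h j \<longleftrightarrow> snd g i < snd g j"
    if "i \<in> {1..n}" "j \<in> {1..n}" "Suc b < snd g i" "Suc b < snd g j" for i j
    using above'[OF that(1,3)] above'[OF that(2,4)] that by auto
  have mono_q: "snd ?h i < m \<longleftrightarrow> snd g i \<le> m" "m < snd ?h i \<longleftrightarrow> \<not> snd g i \<le> m"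
    if "i \<in> {1..n}" "Suc b < snd g i" for i
    using above'[OF that] that by auto
  have order: "(\<forall>i\<in>{1..n}. \<forall>j\<in>{1..n}. i < j \<and> b < snd ?h i \<and> b < snd ?h j \<longrightarrow> snd ?h i < snd ?h j) \<longleftrightarrow>
      (\<forall>i\<in>{1..n}. \<forall>j\<in>{1..n}. i < j \<and> Suc b < snd g i \<and> Suc b < snd g j \<longrightarrow> snd g i < snd g j) \<and>
      (\<forall>i\<in>{1..n}. Suc b < snd g i \<longrightarrow> (i < q \<longleftrightarrow> snd g i \<le> m))" (is "?L \<longleftrightarrow> ?R1 \<and> ?R2")
  proof (intro iffI conjI)
    assume L: ?L
    show ?R1
    proof (intro ballI impI, elim conjE)
      fix i j assume ij: "i \<in> {1..n}" "j \<in> {1..n}" "i < j" "Suc b < snd g i" "Suc b < snd g j"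
      then have "snd ?h i < snd ?h j"
        using L above[of i] above[of j] by simp
      then show "snd g i < snd g j"
        using mono[OF ij(1,2,4,5)] by simp
    qed
    show ?R2
    proof (intro ballI impI)
      fix i assume i: "i \<in> {1..n}" "Suc b < snd g i"
      have "b < snd ?h i" "b < snd ?h q"
        using above i q(1) by auto
      then have "i < q \<Longrightarrow> snd ?h i < m" "q < i \<Longrightarrow> m < snd ?h i"
        using L i(1) q(1) h_q(2) by metis+
      then show "i < q \<longleftrightarrow> snd g i \<le> m"
        using above'(1)[OF i] mono_q[OF i] by (meson linorder_neqE_nat)
    qed
  next
    assume R: "?R1 \<and> ?R2"
    show ?L
    proof (intro ballI impI, elim conjE)
      fix i j assume ij: "i \<in> {1..n}" "j \<in> {1..n}" "i < j" "b < snd ?h i" "b < snd ?h j"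
      have "i = q \<or> Suc b < snd g i" "j = q \<or> Suc b < snd g j" "i \<noteq> j"
        using above[OF ij(1)] above[OF ij(2)] ij(3-5) by simp_all
      then consider "i = q" "Suc b < snd g j" | "j = q" "Suc b < snd g i"
        | "Suc b < snd g i" "Suc b < snd g j"
        by metis
      then show "snd ?h i < snd ?h j"
      proof cases
        case 1
        then have "\<not> snd g j \<le> m"
          using R ij(2,3) by auto
        then show ?thesis
          using 1 ij(2) h_q(2) mono_q(2) by simp
      next
        case 2
        then have "snd g i \<le> m"
          using R ij(1,3) by blast
        then show ?thesis
          using 2 ij(1) h_q(2) mono_q(1) by simp
      next
        case 3
        then show ?thesis
          using R ij(1-3) mono[OF ij(1,2)] by simp
      qed
    qed
  qed
  show ?thesis
    unfolding tail_in_order_def color order by blast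
qed

text \<open>The color \<open>c\<close> has to cancel that of the letter 1. The value
  \<open>m\<close> has to be at least every value above \<open>Suc b\<close> left of
  \<open>q\<close> and less than every such value right of \<open>q\<close>. Those values increase
  along the word, so such an \<open>m\<close> exists; they exhaust the numbers from
  \<open>b + 2\<close> to \<open>n\<close>, so it is unique.\<close>

lemma ex1_tail_in_order_move_first:
  assumes g: "g \<in> carrier (colored_perm_group n p)" "p \<ge> 1" and b: "b < n" "tail_in_order n (Suc b) g"
  shows "\<exists>!(c, m). c \<in> carrier (integer_mod_group p) \<and> m \<in> {Suc b..n} \<and>
    tail_in_order n b (move_first n c m \<otimes>\<^bsub>colored_perm_group n p\<^esub> g)"
proof -
  obtain s \<sigma> where g_eq: "g = (s, \<sigma>)" by force
  have \<sigma>: "\<sigma> permutes {1..n}"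
    using g by (auto simp: g_eq carrier_colored_perm_group)
  have image: "\<sigma> ` {1..n} = {1..n}"
    using \<sigma> by (rule permutes_image)
  have "1 \<in> \<sigma> ` {1..n}"
    unfolding image using b by simp
  then obtain q where q: "q \<in> {1..n}" "\<sigma> q = 1"
    by (auto simp: image_iff)
  define c where "c = (- s q) mod int p"
  have c: "x = c \<longleftrightarrow> (x + s q) mod int p = 0" if "x \<in> {0..<int p}" for x
  proof -
    have "(x + s q) mod int p = 0 \<longleftrightarrow> x mod int p = (- s q) mod int p"
      by (simp add: mod_eq_dvd_iff mod_eq_0_iff_dvd)
    then show ?thesis
      using that by (simp add: c_def)
  qed
  \<comment> \<open>\<open>Suc b\<close> is the default for \<open>m\<close> when no larger value
    stands left of \<open>q\<close>.\<close>
  define M where "M = insert (Suc b) {\<sigma> i | i. i \<in> {1..n} \<and> i < q \<and> Suc b < \<sigma> i}"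
  define m where "m = Max M"
  have "M \<subseteq> {Suc b..n}"
    using b image by (auto simp: M_def)
  then have M: "finite M"
    by (rule finite_subset) simp
  have m: "m \<in> M" "\<And>x. x \<in> M \<Longrightarrow> x \<le> m"
    using Max_in[OF M] Max_ge[OF M] by (auto simp: m_def M_def)
  have sep: "i < q \<longleftrightarrow> \<sigma> i \<le> m" if i: "i \<in> {1..n}" "Suc b < \<sigma> i" for i
  proof
    assume "i < q"
    then show "\<sigma> i \<le> m"
      using i by (intro m(2)) (auto simp: M_def)
  next
    assume le: "\<sigma> i \<le> m"
    \<comment> \<open>Being at least \<open>\<sigma> i\<close>, the maximum \<open>m\<close> exceeds
      the default \<open>Suc b\<close>, so it is the value at some \<open>j\<close> left of
      \<open>q\<close>. The large values increase, hence \<open>i\<close> cannot lie beyond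
      \<open>j\<close>.\<close>
    then obtain j where j: "j \<in> {1..n}" "j < q" "\<sigma> j = m" "Suc b < \<sigma> j"
      using m(1) i le unfolding M_def by auto
    have "\<sigma> j < \<sigma> i" if "j < i"
      using b(2) i j(1,4) that unfolding tail_in_order_def g_eq snd_conv by blast
    then have "\<not> j < i"
      using j le by auto
    then show "i < q"
      using j by simp
  qed
  note iff = tail_in_order_move_first_gt[OF g, of b _ q, unfolded g_eq fst_conv snd_conv, OF _ q]
  show ?thesis
  proof (rule ex1I[of _ "(c, m)"], goal_cases)
    case 1
    have "c \<in> {0..<int p}"
      using g(2) by (simp add: c_def)
    moreover have "m \<in> {Suc b..n}"
      using m(1) \<open>M \<subseteq> _\<close> by auto
    ultimately show ?case
      using iff[of m c] c[of c] b(2) sep g(2) by (simp add: carrier_integer_mod_group g_eq)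
  next
    case (2 x)
    then obtain c' m' where x: "x = (c', m')" and c': "c' \<in> {0..<int p}" and m': "m' \<in> {Suc b..n}"
      and tail: "tail_in_order n b (move_first n c' m' \<otimes>\<^bsub>colored_perm_group n p\<^esub> (s, \<sigma>))"
      using g(2) by (auto simp: carrier_integer_mod_group g_eq)
    have "b < m'"
      using m' by simp
    then have "(c' + s q) mod int p = 0"
      and sep': "\<And>i. i \<in> {1..n} \<Longrightarrow> Suc b < \<sigma> i \<Longrightarrow> i < q \<longleftrightarrow> \<sigma> i \<le> m'"
      using iffD1[OF iff tail] by blast+
    then have "c' = c"
      using c[OF c'] by simp
    have "m \<le> m'"
      using m(1) m' sep' by (auto simp: M_def)
    moreover have "m' \<le> m"
    proof (cases "m' = Suc b")
      case True
      then show ?thesis by (intro m(2)) (simp add: M_def)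
    next
      case False
      \<comment> \<open>Above the default, \<open>m'\<close> is itself a value of \<open>g\<close>,
        at position \<open>i\<close>: \<open>sep'\<close> puts \<open>i\<close> left of
        \<open>q\<close>, and then \<open>sep\<close> bounds \<open>m'\<close> by
        \<open>m\<close>.\<close>
      have "m' \<in> \<sigma> ` {1..n}"
        unfolding image using m' by simp
      then obtain i where i: "i \<in> {1..n}" "m' = \<sigma> i"
        by blast
      then have "Suc b < \<sigma> i"
        using False m' by simp
      then show ?thesis
        using i sep[of i] sep'[of i] by simp
    qed
    ultimately show ?case
      using x \<open>c' = c\<close> by simp
  qed
qed

section \<open>\<open>B\<close> as an indicator function\<close>

text \<open>All values are positive, so at threshold 0 every letter is constrained: the colors
  vanish and the values increase. A permutation with increasing values is the identity.\<close>

lemma tail_in_order_0: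
  assumes "g \<in> carrier (colored_perm_group n p)"
  shows "tail_in_order n 0 g \<longleftrightarrow> g = \<one>\<^bsub>colored_perm_group n p\<^esub>"
proof
  assume tail: "tail_in_order n 0 g"
  obtain s \<sigma> where g: "g = (s, \<sigma>)" by force
  have \<sigma>: "\<sigma> permutes {1..n}" and s: "s \<in> extensional {1..n}"
    using assms by (auto simp: g carrier_colored_perm_group PiE_def)
  have pos: "0 < \<sigma> i" if "i \<in> {1..n}" for i
    using permutes_in_image[OF \<sigma>, of i] that by auto
  have "s = (\<lambda>i\<in>{1..n}. 0)"
    using tail pos s by (intro extensionalityI[of _ "{1..n}"]) (auto simp: tail_in_order_def g)
  moreover have "\<sigma> = id"
  proof -
    have "map \<sigma> [1..<Suc n] = [1..<Suc n]"
    proof (rule sorted_distinct_set_unique)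
      have "sorted_wrt (<) (map \<sigma> [1..<Suc n])"
        using tail pos unfolding sorted_wrt_map
        by (intro sorted_wrt_mono_rel[OF _ sorted_wrt_upt]) (auto simp: tail_in_order_def g)
      then show "sorted (map \<sigma> [1..<Suc n])"
        by (simp add: strict_sorted_iff)
      show "distinct (map \<sigma> [1..<Suc n])"
        using permutes_inj_on[OF \<sigma>] by (simp add: distinct_map)
      have "set [1..<Suc n] = {1..n}"
        by auto
      then show "set (map \<sigma> [1..<Suc n]) = set [1..<Suc n]"
        using permutes_image[OF \<sigma>] by (simp del: upt_Suc)
    qed (simp_all del: upt_Suc)
    then have "map \<sigma> [1..<Suc n] = map id [1..<Suc n]"
      by (simp del: upt_Suc)
    then have "\<forall>i\<in>set [1..<Suc n]. \<sigma> i = id i"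
      unfolding map_eq_conv .
    then have "\<sigma> i = i" if "i \<in> {1..n}" for i
      using that by (simp del: upt_Suc)
    then show ?thesis
      using permutes_not_in[OF \<sigma>] by (auto simp: fun_eq_iff)
  qed
  ultimately show "g = \<one>\<^bsub>colored_perm_group n p\<^esub>"
    by (simp add: g colored_perm_group_def)
next
  assume "g = \<one>\<^bsub>colored_perm_group n p\<^esub>"
  then show "tail_in_order n 0 g"
    by (simp add: colored_perm_group_def tail_in_order_def)
qed

text \<open>In a strictly increasing list the order of the entries is that of their indices. This
  turns sortedness of a list of positions into the pairwise condition of
  \<open>tail_in_order\<close>.\<close>

lemma sorted_wrt_set_nth:
  assumes "sorted_wrt Q xs" "sorted_wrt (<) xs" "x \<in> set xs" "y \<in> set xs" "x < (y :: nat)"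
  shows "Q x y"
proof -
  obtain i j where ij: "i < length xs" "x = xs ! i" "j < length xs" "y = xs ! j"
    using assms(3,4) by (auto simp: in_set_conv_nth)
  then have "\<not> j \<le> i"
    using assms(2,5) sorted_wrt_nth_less[OF assms(2), of j i] by (cases "i = j") auto
  then show ?thesis
    using assms(1) ij by (simp add: sorted_wrt_nth_less)
qed

lemma filter_word_of_eq_W_iff:
  assumes "g \<in> carrier (colored_perm_group n p)"
  shows "filter (\<lambda>x. \<not> snd x \<le> k) (word_of n g) = W k n \<longleftrightarrow> tail_in_order n k g"
proof -
  obtain s \<sigma> where g: "g = (s, \<sigma>)" by force
  have \<sigma>: "\<sigma> permutes {1..n}"
    using assms by (auto simp: g carrier_colored_perm_group)
  define xs where "xs = filter (\<lambda>i. k < \<sigma> i) [1..<Suc n]"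
  have xs: "set xs = {i \<in> {1..n}. k < \<sigma> i}" "sorted_wrt (<) xs" "distinct xs"
    by (auto simp: xs_def sorted_wrt_filter simp del: upt_Suc)
  have "filter (\<lambda>x. \<not> snd x \<le> k) (word_of n g) = map (\<lambda>i. (s i, \<sigma> i)) xs"
    by (simp add: word_of_def filter_map o_def g xs_def not_le del: upt_Suc)
  also have "\<dots> = W k n \<longleftrightarrow> tail_in_order n k g"
  proof
    assume eq: "map (\<lambda>i. (s i, \<sigma> i)) xs = W k n"
    have "map fst (map (\<lambda>i. (s i, \<sigma> i)) xs) = map (\<lambda>_. 0) [Suc k..<Suc n]"
      unfolding eq by (simp add: W_def o_def del: upt_Suc)
    then have "set (map s xs) \<subseteq> {0}"
      by (simp add: o_def image_subset_iff del: upt_Suc)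
    then have "s i = 0" if "i \<in> set xs" for i
      using that by auto
    moreover have "map snd (map (\<lambda>i. (s i, \<sigma> i)) xs) = [Suc k..<Suc n]"
      unfolding eq by (simp add: W_def o_def del: upt_Suc)
    then have "map \<sigma> xs = [Suc k..<Suc n]"
      by (simp add: o_def del: upt_Suc)
    then have "sorted_wrt (<) (map \<sigma> xs)"
      by (simp del: upt_Suc)
    then have "sorted_wrt (\<lambda>i j. \<sigma> i < \<sigma> j) xs"
      by (simp add: sorted_wrt_map)
    then have "\<sigma> i < \<sigma> j" if "i \<in> set xs" "j \<in> set xs" "i < j" for i j
      using xs(2) that by (rule sorted_wrt_set_nth)
    ultimately show "tail_in_order n k g"
      using xs(1) by (auto simp: tail_in_order_def g)
  next
    assume tail: "tail_in_order n k g"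
    have "sorted_wrt (<) (map \<sigma> xs)"
      using xs tail unfolding sorted_wrt_map
      by (intro sorted_wrt_mono_rel[OF _ xs(2)]) (auto simp: tail_in_order_def g)
    \<comment> \<open>The values above \<open>k\<close> of a permutation are always
      \<open>k + 1, ..., n\<close>, so their increasing order determines the list.\<close>
    moreover have "\<sigma> ` {i \<in> {1..n}. k < \<sigma> i} = {x \<in> \<sigma> ` {1..n}. k < x}"
      by auto
    then have "set (map \<sigma> xs) = set [Suc k..<Suc n]"
      unfolding permutes_image[OF \<sigma>] by (auto simp: xs(1) simp del: upt_Suc)
    ultimately have eq: "map \<sigma> xs = [Suc k..<Suc n]"
      by (intro sorted_distinct_set_unique) (simp_all add: strict_sorted_iff del: upt_Suc)
    have "map (\<lambda>i. (s i, \<sigma> i)) xs = map (\<lambda>i. (0, \<sigma> i)) xs"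
      using tail xs(1) by (auto simp: tail_in_order_def g)
    also have "\<dots> = W k n"
      unfolding W_def eq[symmetric] by simp
    finally show "map (\<lambda>i. (s i, \<sigma> i)) xs = W k n" .
  qed
  finally show ?thesis .
qed

lemma inj_on_word_of: "inj_on (word_of k) (carrier (colored_perm_group k p))"
proof (rule inj_onI)
  fix g h assume g: "g \<in> carrier (colored_perm_group k p)" and h: "h \<in> carrier (colored_perm_group k p)"
    and eq: "word_of k g = word_of k h"
  from eq have *: "fst g i = fst h i" "snd g i = snd h i" if "i \<in> {1..k}" for i
    using that by (auto simp: word_of_def simp del: upt_Suc)
  have "fst g = fst h"
    using g h * by (intro extensionalityI[of _ "{1..k}"]) (auto simp: carrier_colored_perm_group PiE_def)
  moreover have "snd g i = snd h i" for i
    using g h * by (cases "i \<in> {1..k}") (auto simp: carrier_colored_perm_group permutes_not_in)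
  ultimately show "g = h"
    by (auto simp: prod_eq_iff)
qed

text \<open>A list of length \<open>k\<close> whose values exhaust \<open>{1..k}\<close> repeats
  none of them, so it is the word of a colored permutation. This supplies the summand that
  contributes to \<open>B\<close>.\<close>

lemma ex_word_of:
  assumes "length ws = k" "fst ` set ws \<subseteq> carrier (integer_mod_group p)" "snd ` set ws = {1..k}"
  shows "\<exists>\<alpha>\<in>carrier (colored_perm_group k p). word_of k \<alpha> = ws"
proof -
  let ?\<sigma> = "\<lambda>i. if i \<in> {1..k} then snd (ws ! (i - 1)) else i"
  define \<alpha> where "\<alpha> = (\<lambda>i\<in>{1..k}. fst (ws ! (i - 1)), ?\<sigma>)"
  have "{1..k} = Suc ` {..<k}"
    by (simp add: image_Suc_lessThan)
  then have "?\<sigma> ` {1..k} = (\<lambda>i. snd (ws ! i)) ` {..<k}"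
    by (simp add: image_image)
  also have "\<dots> = {1..k}"
    using assms(1) unfolding assms(3)[symmetric] by (force simp: set_conv_nth)
  finally have image: "?\<sigma> ` {1..k} = {1..k}" .
  then have "bij_betw ?\<sigma> {1..k} {1..k}"
    unfolding bij_betw_def by (intro conjI finite_surj_inj) auto
  then have "?\<sigma> permutes {1..k}"
    by (rule bij_imp_permutes) (rule if_not_P)
  then have "\<alpha> \<in> carrier (colored_perm_group k p)"
    using assms(1,2) by (fastforce simp: \<alpha>_def carrier_colored_perm_group)
  moreover have "word_of k \<alpha> = ws"
    using assms(1) by (intro nth_equalityI) (auto simp: word_of_def \<alpha>_def simp del: upt_Suc)
  ultimately show ?thesis
    by blast
qed

text \<open>For \<open>0 < k < n\<close> the letters of \<open>\<alpha>\<close> have values up to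
  \<open>k\<close> and those of \<open>W k n\<close> larger ones, so a shuffle count is 0 or 1. It
  is 1 when the small letters of \<open>g\<close> spell \<open>\<alpha>\<close> and the large ones
  spell \<open>W k n\<close>. The small letters spell exactly one \<open>\<alpha>\<close>, which
  leaves the condition on the large ones.\<close>

lemma B_eq_of_bool:
  assumes "p \<ge> 1" "k \<le> n" and g: "g \<in> carrier (colored_perm_group n p)"
  shows "B n p k g = of_bool (tail_in_order n k g)"
proof -
  have snd_le: "snd h i \<le> m" if "h \<in> carrier (colored_perm_group m p)" "i \<in> {1..m}" for h m i
    using move_first_mult(3)[OF that assms(1)] by simp
  consider "k = 0" | "0 < k" "k = n" | "0 < k" "k < n"
    using assms(2) by linarith
  then show ?thesis
  proof cases
    case 1
    then show ?thesis
      using g by (simp add: B_def tail_in_order_0)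
  next
    case 2
    \<comment> \<open>No value exceeds \<open>n\<close>, so the condition is void.\<close>
    have "tail_in_order n k g"
      using 2 snd_le[OF g] by (force simp: tail_in_order_def)
    then show ?thesis
      using 2 g by (simp add: B_def)
  next
    case 3
    obtain s \<sigma> where g_eq: "g = (s, \<sigma>)" by force
    have \<sigma>: "\<sigma> permutes {1..n}"
      using g by (auto simp: g_eq carrier_colored_perm_group)
    let ?C = "carrier (colored_perm_group k p)"
    let ?ws = "filter (\<lambda>x. snd x \<le> k) (word_of n g)"
    have "B n p k g =
        (\<Sum>\<alpha>\<in>?C. of_nat (count (shuffle_product (word_of k \<alpha>) (W k n)) (word_of n g)))"
      using 3 g by (simp add: B_def)
    also have "\<dots> = (\<Sum>\<alpha>\<in>?C. of_bool (?ws = word_of k \<alpha> \<and> tail_in_order n k g))"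
    proof (rule sum.cong[OF refl])
      fix \<alpha> assume \<alpha>: "\<alpha> \<in> ?C"
      have "\<forall>x\<in>set (word_of k \<alpha>). snd x \<le> k"
        using snd_le[OF \<alpha>] by (auto simp: word_of_def simp del: upt_Suc)
      moreover have "\<forall>x\<in>set (W k n). \<not> snd x \<le> k"
        by (auto simp: W_def)
      ultimately show "of_nat (count (shuffle_product (word_of k \<alpha>) (W k n)) (word_of n g)) =
          (of_bool (?ws = word_of k \<alpha> \<and> tail_in_order n k g) :: rat)"
        by (subst count_shuffle_product[where P = "\<lambda>x. snd x \<le> k"])
           (simp_all add: filter_word_of_eq_W_iff[OF g])
    qed
    also have "\<dots> = of_bool (tail_in_order n k g)"
    proof -
      define xs where "xs = filter (\<lambda>i. \<sigma> i \<le> k) [1..<Suc n]"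
      have xs: "set xs = {i \<in> {1..n}. \<sigma> i \<le> k}" "distinct xs"
        by (auto simp: xs_def simp del: upt_Suc)
      have ws: "?ws = map (\<lambda>i. (s i, \<sigma> i)) xs"
        by (simp add: word_of_def filter_map o_def g_eq xs_def del: upt_Suc)
      have "\<sigma> ` {i \<in> {1..n}. \<sigma> i \<le> k} = {x \<in> \<sigma> ` {1..n}. x \<le> k}"
        by auto
      also have "\<dots> = {1..k}"
        unfolding permutes_image[OF \<sigma>] using 3 by auto
      finally have image: "\<sigma> ` set xs = {1..k}"
        by (simp add: xs(1))
      have "length xs = card (\<sigma> ` set xs)"
        using xs(2) permutes_inj_on[OF \<sigma>] by (simp add: card_image distinct_card)
      then have "length ?ws = k"
        by (simp add: ws image)
      moreover have "snd ` set ?ws = {1..k}"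
        unfolding ws by (simp add: image_image image del: atLeastAtMost_iff)
      moreover have "s i \<in> carrier (integer_mod_group p)" if "i \<in> set xs" for i
        using that g xs(1) by (auto simp: g_eq carrier_colored_perm_group)
      then have "fst ` set ?ws \<subseteq> carrier (integer_mod_group p)"
        by (auto simp: ws)
      ultimately obtain \<alpha> where \<alpha>: "\<alpha> \<in> ?C" "word_of k \<alpha> = ?ws"
        using ex_word_of by blast
      then have "?ws = word_of k \<beta> \<longleftrightarrow> \<beta> = \<alpha>" if "\<beta> \<in> ?C" for \<beta>
        using inj_onD[OF inj_on_word_of _ that \<alpha>(1)] by auto
      then have "(\<Sum>\<beta>\<in>?C. of_bool (?ws = word_of k \<beta> \<and> tail_in_order n k g)) =
          (\<Sum>\<beta>\<in>?C. if \<beta> = \<alpha> then of_bool (tail_in_order n k g) else 0 :: rat)"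
        by (intro sum.cong) auto
      then show ?thesis
        using \<alpha>(1) finite_colored_perm_group[OF assms(1)] by simp
    qed
    finally show ?thesis .
  qed
qed

section \<open>The product of \<open>B n p 1\<close> and \<open>B n p b\<close>\<close>

text \<open>\<open>y\<close> is the inverse of \<open>move_first n c m\<close> exactly when their
  product is the identity, that is, satisfies \<open>tail_in_order n 0\<close>. Both inclusions are
  therefore the case \<open>b = 0\<close> of the passage between \<open>b\<close> and
  \<open>Suc b\<close>; \<open>c\<close> and \<open>m\<close> are recovered as the color and value
  at position 1.\<close>

lemma bij_betw_inv_move_first:
  assumes "p \<ge> 1" "n \<ge> 1"
  shows "bij_betw (\<lambda>(c, m). inv\<^bsub>colored_perm_group n p\<^esub> move_first n c m)
    (carrier (integer_mod_group p) \<times> {1..n})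
    {y \<in> carrier (colored_perm_group n p). tail_in_order n 1 y}"
proof -
  let ?G = "colored_perm_group n p" and ?C = "carrier (integer_mod_group p)"
  interpret group ?G by (rule group_colored_perm_group)
  have carrier: "move_first n c m \<in> carrier ?G" if "c \<in> ?C" "m \<in> {1..n}" for c m
    using move_first_carrier that .
  show ?thesis
  proof (rule bij_betw_imageI)
    show "inj_on (\<lambda>(c, m). inv\<^bsub>?G\<^esub> move_first n c m) (?C \<times> {1..n})"
    proof (rule inj_onI, clarify)
      fix c m c' m' assume "c \<in> ?C" "m \<in> {1..n}" "c' \<in> ?C" "m' \<in> {1..n}"
        and "inv\<^bsub>?G\<^esub> move_first n c m = inv\<^bsub>?G\<^esub> move_first n c' m'"
      then have "move_first n c m = move_first n c' m'"
        using carrier inv_inj by (metis inj_onD)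
      then have "fst (move_first n c m) 1 = fst (move_first n c' m') 1"
        "snd (move_first n c m) 1 = snd (move_first n c' m') 1"
        by simp_all
      then show "c = c' \<and> m = m'"
        using assms(2) by (simp add: move_first_def)
    qed
    show "(\<lambda>(c, m). inv\<^bsub>?G\<^esub> move_first n c m) ` (?C \<times> {1..n}) =
        {y \<in> carrier ?G. tail_in_order n 1 y}" (is "?f ` ?X = ?Y")
    proof (rule Set.set_eqI)
      fix y
      show "y \<in> ?f ` ?X \<longleftrightarrow> y \<in> ?Y"
      proof
        assume "y \<in> ?f ` ?X"
        then obtain c m where cm: "c \<in> ?C" "m \<in> {1..n}" and y: "y = inv\<^bsub>?G\<^esub> move_first n c m"
          by auto
        have yG: "y \<in> carrier ?G"
          using carrier[OF cm] by (simp add: y)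
        obtain q where q: "q \<in> {1..n}" "snd y q = 1"
          using ex_snd_eq[OF yG, of 1] assms(2) by auto
        have "tail_in_order n 0 (move_first n c m \<otimes>\<^bsub>?G\<^esub> y)"
          using carrier[OF cm] tail_in_order_0[OF one_closed] by (simp add: y)
        then have "tail_in_order n 1 y"
          using tail_in_order_move_first_gt[OF yG assms(1) _ q, of 0] cm(2) by simp
        then show "y \<in> ?Y"
          using yG by simp
      next
        assume "y \<in> ?Y"
        then have y: "y \<in> carrier ?G" "tail_in_order n (Suc 0) y"
          by simp_all
        obtain c m where cm: "c \<in> ?C" "m \<in> {1..n}"
          and "tail_in_order n 0 (move_first n c m \<otimes>\<^bsub>?G\<^esub> y)"
          using ex1_implies_ex[OF ex1_tail_in_order_move_first[OF y(1) assms(1) _ y(2)]] assms(2) by auto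
        then have "move_first n c m \<otimes>\<^bsub>?G\<^esub> y = \<one>\<^bsub>?G\<^esub>"
          using tail_in_order_0[OF m_closed[OF carrier[OF cm] y(1)]] by simp
        then have "y = inv\<^bsub>?G\<^esub> move_first n c m"
          using carrier[OF cm] y(1) by (metis inv_equality inv_inv)
        then show "y \<in> ?f ` ?X"
          using cm by auto
      qed
    qed
  qed
qed

text \<open>The \<open>p * b\<close> pairs with \<open>m \<le> b\<close> do not change membership.
  Among the pairs with \<open>m > b\<close> exactly one succeeds if \<open>g\<close> satisfies the
  condition for \<open>Suc b\<close>, and none otherwise; for \<open>b = n\<close> there are no such
  pairs.\<close>

lemma sum_tail_in_order_move_first:
  assumes "p \<ge> 1" "b \<le> n" "n \<ge> 1" and g: "g \<in> carrier (colored_perm_group n p)"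
  shows "(\<Sum>(c, m)\<in>carrier (integer_mod_group p) \<times> {1..n}.
      of_bool (tail_in_order n b (move_first n c m \<otimes>\<^bsub>colored_perm_group n p\<^esub> g))) =
    (of_nat (p * b) * of_bool (tail_in_order n b g) + of_bool (b < n \<and> tail_in_order n (Suc b) g) :: rat)"
proof -
  let ?G = "colored_perm_group n p" and ?C = "carrier (integer_mod_group p)"
  let ?f = "\<lambda>(c, m). of_bool (tail_in_order n b (move_first n c m \<otimes>\<^bsub>?G\<^esub> g)) :: rat"
  have C: "finite ?C" "card ?C = p"
    using assms(1) by (simp_all add: carrier_integer_mod_group)
  have "?C \<times> {1..n} = ?C \<times> {1..b} \<union> ?C \<times> {Suc b..n}"
    using assms(2) by auto
  then have "sum ?f (?C \<times> {1..n}) = sum ?f (?C \<times> {1..b}) + sum ?f (?C \<times> {Suc b..n})"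
    using C by (simp only:) (rule sum.union_disjoint, auto)
  also have "sum ?f (?C \<times> {1..b}) = (\<Sum>x\<in>?C \<times> {1..b}. of_bool (tail_in_order n b g))"
    using tail_in_order_move_first_le[OF g assms(1)] by (intro sum.cong) auto
  also have "\<dots> = of_nat (p * b) * of_bool (tail_in_order n b g)"
    by (simp add: card_cartesian_product C)
  also have "sum ?f (?C \<times> {Suc b..n}) = of_bool (b < n \<and> tail_in_order n (Suc b) g)"
  proof (cases "b < n \<and> tail_in_order n (Suc b) g")
    case True
    then obtain x where x: "x \<in> ?C \<times> {Suc b..n}"
      "\<And>y. y \<in> ?C \<times> {Suc b..n} \<Longrightarrow> ?f y = of_bool (y = x)"
    proof -
      obtain x where x: "case x of (c, m) \<Rightarrow> c \<in> ?C \<and> m \<in> {Suc b..n} \<and>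
          tail_in_order n b (move_first n c m \<otimes>\<^bsub>?G\<^esub> g)"
        and unique: "\<And>y. (case y of (c, m) \<Rightarrow> c \<in> ?C \<and> m \<in> {Suc b..n} \<and>
          tail_in_order n b (move_first n c m \<otimes>\<^bsub>?G\<^esub> g)) \<Longrightarrow> y = x"
        using ex1_tail_in_order_move_first[OF g assms(1) conjunct1[OF True] conjunct2[OF True]]
        by (rule ex1E) blast
      show thesis
      proof (rule that[of x])
        show "x \<in> ?C \<times> {Suc b..n}"
          using x by (cases x) simp
        fix y assume "y \<in> ?C \<times> {Suc b..n}"
        then show "?f y = of_bool (y = x)"
          using x unique[of y] by (cases y) auto
      qed
    qed
    then have "sum ?f (?C \<times> {Suc b..n}) = (\<Sum>y\<in>?C \<times> {Suc b..n}. if y = x then 1 else 0)"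
      by (intro sum.cong) auto
    then show ?thesis
      using True x(1) C by simp
  next
    case False
    have "\<not> tail_in_order n b (move_first n c m \<otimes>\<^bsub>?G\<^esub> g)" if "m \<in> {Suc b..n}" for c m
    proof -
      obtain q where q: "q \<in> {1..n}" "snd g q = 1"
        using ex_snd_eq[OF g, of 1] assms(3) by auto
      show ?thesis
        using tail_in_order_move_first_gt[OF g assms(1) _ q] that False by auto
    qed
    then have "sum ?f (?C \<times> {Suc b..n}) = 0"
      by (intro sum.neutral) auto
    then show ?thesis
      using False by simp
  qed
  finally show ?thesis .
qed

lemma B_notin: "g \<notin> carrier (colored_perm_group n p) \<Longrightarrow> B n p k g = 0"
  by (simp add: B_def)

text \<open>Summing over inverses of \<open>move_first\<close> turns the convolution into the count
  above. The factor \<open>of_bool (b < n)\<close> encodes B_(n+1) = 0, since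
  \<open>B n p (Suc n)\<close> as defined is 1 on the group.\<close>

lemma B_1_mult:
  assumes "p \<ge> 1" "b \<le> n" "n \<ge> 1"
  shows "B n p 1 \<otimes>\<^bsub>rat_group_algebra (colored_perm_group n p)\<^esub> B n p b =
    (\<lambda>g. of_nat (p * b) * B n p b g + of_bool (b < n) * B n p (Suc b) g)"
proof
  fix g
  let ?G = "colored_perm_group n p" and ?C = "carrier (integer_mod_group p)"
  interpret group ?G by (rule group_colored_perm_group)
  show "(B n p 1 \<otimes>\<^bsub>rat_group_algebra ?G\<^esub> B n p b) g =
      of_nat (p * b) * B n p b g + of_bool (b < n) * B n p (Suc b) g"
  proof (cases "g \<in> carrier ?G")
    case False
    then show ?thesis
      by (simp add: rat_group_algebra_mult_notin[OF group_colored_perm_group] B_notin)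
  next
    case g: True
    let ?Y = "{y \<in> carrier ?G. tail_in_order n 1 y}"
    have "(B n p 1 \<otimes>\<^bsub>rat_group_algebra ?G\<^esub> B n p b) g =
        (\<Sum>y\<in>carrier ?G. of_bool (tail_in_order n 1 y) * of_bool (tail_in_order n b (inv\<^bsub>?G\<^esub> y \<otimes>\<^bsub>?G\<^esub> g)))"
      unfolding rat_group_algebra_mult[OF group_colored_perm_group g]
      using assms g by (intro sum.cong refl) (simp add: B_eq_of_bool)
    also have "\<dots> = (\<Sum>y\<in>?Y. of_bool (tail_in_order n b (inv\<^bsub>?G\<^esub> y \<otimes>\<^bsub>?G\<^esub> g)))"
      using finite_colored_perm_group[OF assms(1), of n] by (intro sum.mono_neutral_cong_right) auto
    also have "\<dots> = (\<Sum>x\<in>?C \<times> {1..n}. of_bool (tail_in_order n b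
        (inv\<^bsub>?G\<^esub> (case x of (c, m) \<Rightarrow> inv\<^bsub>?G\<^esub> move_first n c m) \<otimes>\<^bsub>?G\<^esub> g)))"
      by (rule sum.reindex_bij_betw[OF bij_betw_inv_move_first[OF assms(1,3)], symmetric])
    also have "\<dots> = (\<Sum>(c, m)\<in>?C \<times> {1..n}. of_bool (tail_in_order n b (move_first n c m \<otimes>\<^bsub>?G\<^esub> g)))"
      by (intro sum.cong refl) (auto simp: move_first_carrier)
    also have "\<dots> = of_nat (p * b) * of_bool (tail_in_order n b g) + of_bool (b < n \<and> tail_in_order n (Suc b) g)"
      using sum_tail_in_order_move_first[OF assms g] .
    also have "\<dots> = of_nat (p * b) * B n p b g + of_bool (b < n) * B n p (Suc b) g"
      using assms g by (cases "b < n") (simp_all add: B_eq_of_bool)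
    finally show ?thesis .
  qed
qed

section \<open>Eigenvectors and the decomposition of the identity\<close>

text \<open>The coefficients come from binomial inversion of the intended expansion of B_b as the
  sum over i of \<open>p^b * b! * (i choose b)\<close> times E_i.\<close>

definition E :: "nat \<Rightarrow> nat \<Rightarrow> nat \<Rightarrow> colored_perm \<Rightarrow> rat" where
  "E n p i = (\<lambda>g. \<Sum>b\<le>n. (- 1) ^ (b + i) * of_nat (b choose i) / (fact b * of_nat p ^ b) * B n p b g)"

text \<open>Comparing the coefficients of \<open>B n p (Suc b)\<close> on both sides leaves the
  recurrence \<open>e_Suc\<close>, and that of \<open>B n p 0\<close> leaves
  \<open>e_0\<close>.\<close>

lemma B_1_mult_E:
  assumes "p \<ge> 1" "n \<ge> 1"
  shows "B n p 1 \<otimes>\<^bsub>rat_group_algebra (colored_perm_group n p)\<^esub> E n p i =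
    (\<lambda>g. of_nat (p * i) * E n p i g)"
proof
  fix g
  define e :: "nat \<Rightarrow> rat" where "e b = (- 1) ^ (b + i) * of_nat (b choose i) / (fact b * of_nat p ^ b)" for b
  have E: "E n p i = (\<lambda>g. \<Sum>b\<le>n. e b * B n p b g)"
    by (simp add: E_def e_def)
  obtain m where n: "n = Suc m"
    using assms(2) by (cases n) auto
  have e_Suc: "e (Suc b) * of_nat (p * Suc b) + e b = of_nat (p * i) * e (Suc b)" for b
  proof -
    \<comment> \<open>Pascal's rule combined with the absorption of \<open>i\<close> into
      \<open>Suc b choose i\<close>.\<close>
    have "Suc b * (Suc b choose i) = Suc b * (b choose i) + i * (Suc b choose i)"
    proof (cases i)
      case (Suc j)
      then show ?thesis
        using Suc_times_binomial[of j b] by (simp add: algebra_simps)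
    qed simp
    then have absorb: "of_nat (Suc b) * of_nat (Suc b choose i) =
        of_nat (Suc b) * of_nat (b choose i) + (of_nat i * of_nat (Suc b choose i) :: rat)"
      unfolding of_nat_mult[symmetric] of_nat_add[symmetric] by (rule arg_cong)
    \<comment> \<open>The common factor of two consecutive coefficients; its sign is that of
      \<open>e (Suc b)\<close>.\<close>
    define d :: rat where "d = - ((- 1) ^ (b + i)) / (fact b * of_nat p ^ b)"
    have e: "e (Suc b) = d * of_nat (Suc b choose i) / (of_nat (Suc b) * of_nat p)"
      "e b = - (d * of_nat (b choose i))"
      by (simp_all add: e_def d_def mult_ac del: of_nat_Suc binomial_Suc_Suc)
    have nz: "of_nat (Suc b) \<noteq> (0 :: rat)" "of_nat p \<noteq> (0 :: rat)"
      using assms(1) by (simp_all del: of_nat_Suc)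
    have "e (Suc b) * of_nat (p * Suc b) + e b =
        d * (of_nat (Suc b) * of_nat (Suc b choose i) - of_nat (Suc b) * of_nat (b choose i)) / of_nat (Suc b)"
      using nz unfolding e of_nat_mult by (simp add: field_simps del: of_nat_Suc binomial_Suc_Suc)
    also have "\<dots> = of_nat (p * i) * e (Suc b)"
      using nz unfolding e of_nat_mult absorb by (simp del: of_nat_Suc binomial_Suc_Suc)
    finally show ?thesis .
  qed
  \<comment> \<open>Either \<open>i = 0\<close> or \<open>0 choose i\<close> vanishes.\<close>
  have e_0: "e 0 * of_nat (p * 0) = of_nat (p * i) * e 0"
    by (cases i) (simp_all add: e_def)
  have "(B n p 1 \<otimes>\<^bsub>rat_group_algebra (colored_perm_group n p)\<^esub> E n p i) g =
      (\<Sum>b\<le>n. e b * (of_nat (p * b) * B n p b g + of_bool (b < n) * B n p (Suc b) g))"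
    unfolding E rat_group_algebra_mult_sum_right using assms by (simp add: B_1_mult del: One_nat_def)
  \<comment> \<open>The cutoff \<open>b < n\<close> ends the second sum at \<open>m = n - 1\<close>;
    shifting the first sum by one then aligns both on \<open>B n p (Suc b)\<close>.\<close>
  also have "\<dots> = (\<Sum>b\<le>n. e b * of_nat (p * b) * B n p b g) + (\<Sum>b\<le>m. e b * B n p (Suc b) g)"
    by (simp add: n sum.distrib algebra_simps)
  also have "\<dots> = e 0 * of_nat (p * 0) * B n p 0 g +
      (\<Sum>b\<le>m. (e (Suc b) * of_nat (p * Suc b) + e b) * B n p (Suc b) g)"
    unfolding n sum.atMost_Suc_shift by (simp add: sum.distrib distrib_right del: of_nat_Suc)
  also have "\<dots> = of_nat (p * i) * (\<Sum>b\<le>n. e b * B n p b g)"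
    unfolding n sum.atMost_Suc_shift e_0 e_Suc by (simp add: distrib_left sum_distrib_left mult.assoc del: of_nat_Suc)
  finally show "(B n p 1 \<otimes>\<^bsub>rat_group_algebra (colored_perm_group n p)\<^esub> E n p i) g = of_nat (p * i) * E n p i g"
    by (simp add: E)
qed

text \<open>By \<open>B_1_mult\<close>, B_(b+1) is B_1 B_b minus p b B_b, so each step multiplies
  the eigenvalue by \<open>p * (i - b)\<close>. The product of these factors is \<open>p^b\<close>
  times a falling factorial of \<open>i\<close>.\<close>

lemma B_mult_E:
  assumes "p \<ge> 1" "b \<le> n"
  shows "B n p b \<otimes>\<^bsub>rat_group_algebra (colored_perm_group n p)\<^esub> E n p i =
    (\<lambda>g. of_nat p ^ b * (fact b * of_nat (i choose b)) * E n p i g)"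
  using assms(2)
proof (induction b)
  let ?A = "rat_group_algebra (colored_perm_group n p)"
  interpret A: monoid ?A
    using group_colored_perm_group finite_colored_perm_group[OF assms(1)]
    by (rule monoid_rat_group_algebra)
  have carrier: "B n p c \<in> carrier ?A" "E n p i \<in> carrier ?A" for c
    by (simp_all add: rat_group_algebra_def E_def B_notin)
  {
    case 0
    interpret group "colored_perm_group n p" by (rule group_colored_perm_group)
    have "B n p 0 = \<one>\<^bsub>?A\<^esub>"
      by (auto simp: B_def rat_group_algebra_def)
    then show ?case
      using carrier(2) by simp
  next
    case (Suc b)
    let ?l = "of_nat p ^ b * (fact b * of_nat (i choose b)) :: rat"
    \<comment> \<open>Stated additively because \<open>i - b\<close> would be truncated for
      \<open>b > i\<close>.\<close>
    have eq: "(i choose b) * i = (i choose b) * b + Suc b * (i choose Suc b)"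
    proof (cases "b \<le> i")
      case True
      then have "(i choose b) * i = (i choose b) * b + (i - b) * (i choose b)"
        by (simp add: mult.commute[of "i - b"] flip: distrib_left)
      also have "(i - b) * (i choose b) = Suc b * (i choose Suc b)"
        using binomial_absorb_comp[of i b] binomial_absorption[of b i] by simp
      finally show ?thesis .
    qed (simp add: binomial_eq_0)
    show ?case
    proof
      fix g
      \<comment> \<open>The triple product is evaluated twice: by associativity here, and by
        expanding B_1 B_b below. The comparison isolates the action of
        \<open>B n p (Suc b)\<close>.\<close>
      have "(B n p 1 \<otimes>\<^bsub>?A\<^esub> B n p b) \<otimes>\<^bsub>?A\<^esub> E n p i = B n p 1 \<otimes>\<^bsub>?A\<^esub> (B n p b \<otimes>\<^bsub>?A\<^esub> E n p i)"
        by (simp add: A.m_assoc carrier)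
      also have "\<dots> = (\<lambda>g. ?l * (of_nat (p * i) * E n p i g))"
        using Suc assms(1) by (simp add: rat_group_algebra_mult_scale_right B_1_mult_E del: One_nat_def)
      finally have "((B n p 1 \<otimes>\<^bsub>?A\<^esub> B n p b) \<otimes>\<^bsub>?A\<^esub> E n p i) g = ?l * (of_nat (p * i) * E n p i g)"
        by (rule fun_cong)
      moreover have "1 \<le> n" "b \<le> n" "b < n"
        using Suc.prems by simp_all
      ultimately have "of_nat (p * b) * (?l * E n p i g) + (B n p (Suc b) \<otimes>\<^bsub>?A\<^esub> E n p i) g =
          ?l * (of_nat (p * i) * E n p i g)"
        using assms(1) Suc.IH by (simp only: B_1_mult rat_group_algebra_mult_lincomb_left) simp
      then have "(B n p (Suc b) \<otimes>\<^bsub>?A\<^esub> E n p i) g = of_nat p ^ Suc b * fact b *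
          (of_nat ((i choose b) * i) - of_nat ((i choose b) * b)) * E n p i g"
        by (simp add: algebra_simps)
      also have "of_nat ((i choose b) * i) - of_nat ((i choose b) * b) = (of_nat (Suc b) * of_nat (i choose Suc b) :: rat)"
        unfolding eq of_nat_add of_nat_mult by simp
      finally show "(B n p (Suc b) \<otimes>\<^bsub>?A\<^esub> E n p i) g =
          of_nat p ^ Suc b * (fact (Suc b) * of_nat (i choose Suc b)) * E n p i g"
        by (simp add: mult_ac del: of_nat_Suc binomial_Suc_Suc)
    qed
  }
qed

text \<open>The coefficient of \<open>B n p b\<close> in the sum is an alternating row sum of
  binomial coefficients, which vanishes unless \<open>b = 0\<close>. The factor 1 gives the shape
  that \<open>rat_group_algebra_mult_sum_right\<close> expects.\<close>

lemma one_eq_sum_E: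
  "\<one>\<^bsub>rat_group_algebra (colored_perm_group n p)\<^esub> = (\<lambda>g. \<Sum>i\<le>n. 1 * E n p i g)"
proof
  fix g
  interpret group "colored_perm_group n p" by (rule group_colored_perm_group)
  have "(\<Sum>i\<le>n. (- 1) ^ (b + i) * of_nat (b choose i)) = (of_bool (b = 0) :: rat)" if "b \<le> n" for b
  proof -
    have "(\<Sum>i\<le>n. (- 1) ^ (b + i) * of_nat (b choose i)) =
        ((- 1) ^ b * (\<Sum>i\<le>b. (- 1) ^ i * of_nat (b choose i)) :: rat)"
      unfolding sum_distrib_left using that
      by (intro sum.mono_neutral_cong_right) (auto simp: power_add mult.assoc binomial_eq_0)
    then show ?thesis
      by (cases "b = 0") (simp_all add: choose_alternating_sum)
  qed
  then have *: "(\<Sum>i\<le>n. (- 1) ^ (b + i) * of_nat (b choose i)) / (fact b * of_nat p ^ b) * B n p b g =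
      (if b = 0 then B n p 0 g else 0)" if "b \<le> n" for b
    using that by simp
  have "(\<Sum>i\<le>n. 1 * E n p i g) =
      (\<Sum>b\<le>n. (\<Sum>i\<le>n. (- 1) ^ (b + i) * of_nat (b choose i)) / (fact b * of_nat p ^ b) * B n p b g)"
    by (simp add: E_def sum_distrib_right sum_divide_distrib) (rule sum.swap)
  also have "\<dots> = (\<Sum>b\<le>n. if b = 0 then B n p 0 g else 0)"
    by (rule sum.cong) (use * in auto)
  also have "\<dots> = \<one>\<^bsub>rat_group_algebra (colored_perm_group n p)\<^esub> g"
    by (simp add: B_def rat_group_algebra_def)
  finally show "\<one>\<^bsub>rat_group_algebra (colored_perm_group n p)\<^esub> g = (\<Sum>i\<le>n. 1 * E n p i g)"
    by (rule sym)
qed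

section \<open>Powers of \<open>B n p a\<close>\<close>

theorem theorem5:
  fixes n p a k :: nat
  assumes "p \<ge> 1" and "k \<ge> 1" and "a \<le> n"
  shows "B n p a [^]\<^bsub>rat_group_algebra (colored_perm_group n p)\<^esub> k =
    (\<lambda>g. \<Sum>b = a..n. of_nat p powi (int k * int a - int b) * gen_stirling a a k b * B n p b g)"
proof
  fix g
  let ?A = "rat_group_algebra (colored_perm_group n p)"
  define c :: "nat \<Rightarrow> rat" where "c i = fact a * of_nat (i choose a)" for i
  interpret A: monoid ?A
    using group_colored_perm_group finite_colored_perm_group[OF assms(1)]
    by (rule monoid_rat_group_algebra)
  have carrier: "B n p a \<in> carrier ?A" "E n p i \<in> carrier ?A" for i
    by (simp_all add: rat_group_algebra_def E_def B_notin)
  have pow: "(B n p a [^]\<^bsub>?A\<^esub> k) \<otimes>\<^bsub>?A\<^esub> E n p i = (\<lambda>g. (of_nat p ^ a * c i) ^ k * E n p i g)" for i and k :: nat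
  proof (induction k)
    case 0
    then show ?case
      using carrier by simp
  next
    case (Suc k)
    then show ?case
      using carrier B_mult_E[OF assms(1,3), of i]
      by (simp add: A.m_assoc rat_group_algebra_mult_scale_right c_def mult_ac)
  qed
  \<comment> \<open>The right-hand side is the coefficient of \<open>B n p b\<close> after each E_i
    has been scaled by the k-th power of its eigenvalue.\<close>
  have scalar: "of_nat p powi (int k * int a - int b) * gen_stirling a a k b =
      (\<Sum>i\<le>n. (of_nat p ^ a * c i) ^ k * ((- 1) ^ (b + i) * of_nat (b choose i) / (fact b * of_nat p ^ b)))"
    if "b \<le> n" for b
  proof -
    \<comment> \<open>Terms with \<open>i > b\<close> vanish through \<open>b choose i\<close>.
      Terms with \<open>i < a\<close> vanish because \<open>c i = 0\<close> and
      \<open>k \<ge> 1\<close>; for \<open>k = 0\<close> the power would be 1.\<close>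
    have "(\<Sum>i = a..b. (- 1) ^ i * of_nat (b choose i) * c i ^ k) =
        (\<Sum>i\<le>n. (- 1) ^ i * of_nat (b choose i) * c i ^ k)"
      using that assms(2) by (intro sum.mono_neutral_left) (auto simp: c_def binomial_eq_0 not_le)
    \<comment> \<open>The exponent can be negative, so the power is split into a quotient, with
      \<open>p\<close> nonzero.\<close>
    moreover have "(of_nat p :: rat) powi (int k * int a - int b) = of_nat p ^ (a * k) / of_nat p ^ b"
      using assms(1) by (simp add: power_int_diff flip: of_nat_mult) (simp add: mult.commute)
    ultimately have "of_nat p powi (int k * int a - int b) * gen_stirling a a k b =
        of_nat p ^ (a * k) / of_nat p ^ b * ((- 1) ^ b / fact b *
          (\<Sum>i\<le>n. (- 1) ^ i * of_nat (b choose i) * c i ^ k))"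
      unfolding gen_stirling_diag c_def[symmetric] by simp
    then show ?thesis
      by (simp add: sum_distrib_left power_mult_distrib power_mult power_add mult_ac)
  qed
  \<comment> \<open>The sum in \<open>gen_stirling_diag\<close> is empty here, which lets the final
    sum start at \<open>a\<close>.\<close>
  have zero: "gen_stirling a a k b = 0" if "b < a" for b
    using that by (simp add: gen_stirling_diag)
  \<comment> \<open>Inserting \<open>\<one>\<close> and splitting it into the E_i reduces the power
    to scalars.\<close>
  have "(B n p a [^]\<^bsub>?A\<^esub> k) g = ((B n p a [^]\<^bsub>?A\<^esub> k) \<otimes>\<^bsub>?A\<^esub> \<one>\<^bsub>?A\<^esub>) g"
    using carrier by simp
  also have "\<dots> = (\<Sum>i\<le>n. (of_nat p ^ a * c i) ^ k * E n p i g)"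
    unfolding one_eq_sum_E rat_group_algebra_mult_sum_right pow by simp
  also have "\<dots> = (\<Sum>b\<le>n. of_nat p powi (int k * int a - int b) * gen_stirling a a k b * B n p b g)"
    by (simp add: scalar E_def sum_distrib_left sum_distrib_right mult.assoc) (rule sum.swap)
  also have "\<dots> = (\<Sum>b = a..n. of_nat p powi (int k * int a - int b) * gen_stirling a a k b * B n p b g)"
    by (rule sum.mono_neutral_right) (auto simp: zero not_le)
  finally show "(B n p a [^]\<^bsub>?A\<^esub> k) g =
    (\<Sum>b = a..n. of_nat p powi (int k * int a - int b) * gen_stirling a a k b * B n p b g)" .
qed

end
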